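(* Let $\Omega$ be an open bounded subset of $\mathbb{R}$. For every $\lambda\in C^\infty(\overline{\Omega})$ with $\lambda>0$ on $\overline{\Omega}$, and all $\phi,\psi\in C^2(\overline{\Omega})$ vanishing on $\partial\Omega$ and both sub-harmonic with respect to the operator $-\nabla(\lambda\nabla)$, one has $$\int_\Omega\lambda(x)\,|\nabla\phi(x)\cdot\nabla\psi(x)|\,dx\leq3\int_\Omega\lambda(x)\,\nabla\phi(x)\cdot\nabla\psi(x)\,dx.$$
   Context: In dimension one, $\nabla$ is the derivative. A function $\phi\in C^2(\overline\Omega)$ is sub-harmonic with respect to $-\nabla(\lambda\nabla)$ if $-\nabla(\lambda\nabla\phi)\leq0$ in $\Omega$. (The inequality is unchanged when $\phi,\psi$ are both replaced by their negatives, so the opposite sign convention for both functions gives an equivalent statement.) *)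

theory Defs
  imports "HOL-Analysis.Analysis"
begin

text \<open>
  \<open>C\<^sup>k\<close> on the closure of an open set \<open>\<Omega>\<close>: \<open>f\<close> is \<open>k\<close> times continuously differentiable
  on \<open>\<Omega>\<close>, and each derivative of order at most \<open>k\<close> extends continuously to \<open>closure \<Omega>\<close>.
  Since \<open>f\<close> itself is regarded as a function on \<open>closure \<Omega>\<close>, it has to be its own
  extension of order 0. Values of \<open>f\<close> outside \<open>closure \<Omega>\<close> play no role, because on the open
  set \<open>\<Omega>\<close> the iterated \<open>deriv\<close> depends only on \<open>f\<close> restricted to \<open>\<Omega>\<close>.
\<close>

definition Ck_closure :: "nat \<Rightarrow> real set \<Rightarrow> (real \<Rightarrow> real) \<Rightarrow> bool" where
  "Ck_closure k \<Omega> f \<longleftrightarrow>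
     continuous_on (closure \<Omega>) f \<and>
     (\<forall>j<k. \<forall>x\<in>\<Omega>. (deriv ^^ j) f differentiable (at x)) \<and>
     (\<forall>j\<le>k. \<exists>g. continuous_on (closure \<Omega>) g \<and> (\<forall>x\<in>\<Omega>. g x = (deriv ^^ j) f x))"

definition Cinf_closure :: "real set \<Rightarrow> (real \<Rightarrow> real) \<Rightarrow> bool" where
  "Cinf_closure \<Omega> f \<longleftrightarrow> (\<forall>k. Ck_closure k \<Omega> f)"

definition neg_div_grad :: "(real \<Rightarrow> real) \<Rightarrow> (real \<Rightarrow> real) \<Rightarrow> real \<Rightarrow> real" where
  "neg_div_grad a f x = - deriv (\<lambda>y. a y * deriv f y) x"

definition subharmonic_wrt :: "(real \<Rightarrow> real) \<Rightarrow> real set \<Rightarrow> (real \<Rightarrow> real) \<Rightarrow> bool" where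
  "subharmonic_wrt a \<Omega> f \<longleftrightarrow> Ck_closure 2 \<Omega> f \<and> (\<forall>x\<in>\<Omega>. neg_div_grad a f x \<le> 0)"

end

theory Submission
  imports Defs
begin

text \<open>
  On a component \<open>(c, d)\<close> of \<open>\<Omega>\<close> the fluxes \<open>u = a \<phi>'\<close> and \<open>v = a \<psi>'\<close> are nondecreasing, and by
  Rolle \<open>u p = 0\<close> and \<open>v q = 0\<close> for some \<open>p, q\<close>, say with \<open>p \<le> q\<close>. Then \<open>u v \<le> 0\<close>
  between \<open>p\<close> and \<open>q\<close>, \<open>u v \<ge> 0\<close> elsewhere, and distinguishing the position of \<open>x\<close> relative to \<open>p\<close> and \<open>q\<close> gives
  \<open>3 u v - \<bar>u v\<bar> \<ge> 2 (v p * u + u q * v)\<close>. Dividing by \<open>a\<close>, the right-hand side becomes a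
  linear combination of \<open>\<phi>'\<close> and \<open>\<psi>'\<close>, whose integrals over \<open>(c, d)\<close> vanish.
\<close>

text \<open>An open set can have infinitely many components, so finite additivity alone does not
  suffice. It settles finite subfamilies; these increase to all of \<open>D\<close>, and
  integrability of \<open>f\<close> lets the integrals pass to the limit.\<close>

lemma set_integral_Union_nonneg:
  fixes f :: "'a \<Rightarrow> real"
  assumes D: "countable D" "disjoint D" "D \<subseteq> sets M"
    and f: "set_integrable M (\<Union>D) f"
    and nonneg: "\<And>C. C \<in> D \<Longrightarrow> 0 \<le> (LINT x:C|M. f x)"
  shows "0 \<le> (LINT x:\<Union>D|M. f x)"
proof -
  \<comment> \<open>An exhaustion of \<open>D\<close> by finite subfamilies: the members with index
    below \<open>n\<close> in the injective numbering \<open>to_nat_on D\<close>. It also covers a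
    finite \<open>D\<close>.\<close>
  define I where "I n = {C \<in> D. to_nat_on D C < n}" for n
  have fin: "finite (I n)" for n
    by (rule finite_imageD[of "to_nat_on D"], rule finite_subset[of _ "{..<n}"])
      (auto simp: I_def intro: inj_on_subset[OF inj_on_to_nat_on[OF D(1)]])
  have ID: "I n \<subseteq> D" for n
    by (auto simp: I_def)
  have sets: "\<Union>(I n) \<in> sets M" for n
    using fin ID D(3) by (meson sets.finite_Union subset_trans)
  have eq: "\<Union>D = (\<Union>n. \<Union>(I n))"
    by (auto simp: I_def)
  have "(\<lambda>n. LINT x:\<Union>(I n)|M. f x) \<longlonglongrightarrow> (LINT x:\<Union>D|M. f x)"
    unfolding eq
  proof (rule set_integral_cont_up)
    show "incseq (\<lambda>n. \<Union>(I n))"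
      by (force simp: I_def incseq_def)
  qed (use sets f in \<open>simp_all only: eq\<close>)
  moreover have "0 \<le> (LINT x:\<Union>(I n)|M. f x)" for n
  proof -
    have "(LINT x:(\<Union>C\<in>I n. C)|M. f x) = (\<Sum>C\<in>I n. LINT x:C|M. f x)"
    proof (rule set_integral_finite_Union[OF fin])
      show "disjoint_family_on (\<lambda>C. C) (I n)"
        using D(2) ID[of n] by (auto simp: disjoint_family_on_def disjoint_def)
    next
      fix C assume "C \<in> I n"
      then have "C \<in> D" using ID by auto
      then show "C \<in> sets M" "set_integrable M C f"
        using D(3) set_integrable_subset[OF f] by auto
    qed
    also have "\<dots> \<ge> 0"
      using nonneg ID by (intro sum_nonneg) auto
    finally show ?thesis by simp
  qed
  ultimately show ?thesis
    by (intro LIMSEQ_le_const) auto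
qed

text \<open>Connectedness fills the gap between infimum and supremum, and openness excludes both
  from \<open>C\<close>. The frontier of a component lies in the frontier of \<Omega>, which makes
  the boundary condition available at \<open>c\<close> and \<open>d\<close>.\<close>

lemma open_bounded_component_real:
  fixes \<Omega> :: "real set"
  assumes "open \<Omega>" "bounded \<Omega>" "C \<in> components \<Omega>"
  obtains c d where "c < d" "C = {c<..<d}" "c \<in> frontier \<Omega>" "d \<in> frontier \<Omega>"
proof -
  have C: "open C" "connected C" "C \<noteq> {}" "C \<subseteq> \<Omega>"
    using open_components[OF assms(1,3)] in_components_connected[OF assms(3)]
      in_components_nonempty[OF assms(3)] in_components_subset[OF assms(3)] .
  have bd: "bounded C"
    using bounded_subset[OF assms(2) C(4)] .
  have nbr: "\<exists>y\<in>C. y < x" "\<exists>y\<in>C. x < y" if x: "x \<in> C" for x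
  proof -
    obtain e where e: "e > 0" "ball x e \<subseteq> C"
      using openE[OF C(1) x] .
    then have "x - e/2 \<in> ball x e" "x + e/2 \<in> ball x e"
      by (auto simp: dist_real_def)
    with e have "x - e/2 \<in> C" "x + e/2 \<in> C"
      by blast+
    moreover have "x - e/2 < x" "x < x + e/2"
      using e by simp_all
    ultimately show "\<exists>y\<in>C. y < x" "\<exists>y\<in>C. x < y"
      by blast+
  qed
  have below: "Inf C \<le> x" and above: "x \<le> Sup C" if "x \<in> C" for x
    using cInf_lower[OF that bounded_imp_bdd_below[OF bd]]
      cSup_upper[OF that bounded_imp_bdd_above[OF bd]] by simp_all
  \<comment> \<open>An extremum lying in \<open>C\<close> would have a neighbour in \<open>C\<close>
    beyond it.\<close>
  have nz: "Inf C \<notin> C" "Sup C \<notin> C"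
    using nbr(1)[of "Inf C"] nbr(2)[of "Sup C"] below above leD by metis+
  have eq: "C = {Inf C<..<Sup C}"
  proof
    show "{Inf C<..<Sup C} \<subseteq> C"
    proof
      fix x assume x: "x \<in> {Inf C<..<Sup C}"
      obtain y z where "y \<in> C" "y < x" "z \<in> C" "x < z"
        using cInf_lessD[OF C(3), of x] less_cSupD[OF C(3), of x] x by fastforce
      then show "x \<in> C"
        using connectedD_interval[OF C(2), of y z x] by simp
    qed
    show "C \<subseteq> {Inf C<..<Sup C}"
    proof
      fix x assume x: "x \<in> C"
      then have "Inf C \<le> x" "x \<le> Sup C"
        using below above by simp_all
      moreover have "Inf C \<noteq> x" "x \<noteq> Sup C"
        using nz x by auto
      ultimately show "x \<in> {Inf C<..<Sup C}" by simp
    qed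
  qed
  obtain x where "x \<in> C"
    using C(3) by blast
  then have lt: "Inf C < Sup C"
    using below above nz order_less_le_trans order_less_le by metis
  have "frontier {Inf C<..<Sup C} = {Inf C, Sup C}"
    using lt by (auto simp: frontier_def)
  then have "frontier C = {Inf C, Sup C}"
    by (simp only: eq[symmetric])
  then have "Inf C \<in> frontier \<Omega>" "Sup C \<in> frontier \<Omega>"
    using frontier_of_components_subset[OF assms(3)] by blast+
  with that[OF lt eq] show ?thesis .
qed

text \<open>By monotonicity \<open>v p \<le> 0 \<le> u q\<close>. Outside \<open>[p, q]\<close> the
  left side is \<open>2 * (u x * v x)\<close>; there one term on the right is dominated and the
  other is nonpositive. Inside it is \<open>4 * (u x * v x)\<close>, and each term is dominated.
  With a factor \<open>K\<close> for 3 these coefficients are \<open>K - 1\<close> and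
  \<open>K + 1\<close>; the second is twice the first exactly for \<open>K = 3\<close>.\<close>

lemma mono_zero_product_bound:
  fixes u v :: "real \<Rightarrow> real"
  assumes mono: "mono_on S u" "mono_on S v"
    and S: "p \<in> S" "q \<in> S" "x \<in> S" and zero: "u p = 0" "v q = 0" and pq: "p \<le> q"
  shows "3 * (u x * v x) - \<bar>u x * v x\<bar> \<ge> 2 * (v p * u x + u q * v x)"
proof -
  have P: "u p \<le> u q" "v p \<le> v q"
    using mono S pq by (auto intro: mono_onD)
  consider "x \<le> p" | "p \<le> x" "x \<le> q" | "q \<le> x" by linarith
  then show ?thesis
  proof cases
    case 1
    then have "u x \<le> 0" "v x \<le> v p"
      using mono S zero by (metis mono_onD)+
    moreover from this have "u x * v x \<ge> u x * v p" "u q * v x \<le> 0" "u x * v x \<ge> 0"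
      using P zero by (auto intro!: mult_left_mono_neg mult_nonneg_nonpos mult_nonpos_nonpos)
    ultimately show ?thesis by (simp add: algebra_simps)
  next
    case 2
    then have "0 \<le> u x" "u x \<le> u q" "v p \<le> v x" "v x \<le> 0"
      using mono S zero by (metis mono_onD)+
    \<comment> \<open>Each of the first two bounds enters twice, which uses up the coefficient
      4.\<close>
    moreover from this have "u x * v p \<le> u x * v x" "u q * v x \<le> u x * v x" "u x * v x \<le> 0"
      using P zero by (auto intro!: mult_left_mono mult_right_mono_neg mult_nonneg_nonpos)
    ultimately show ?thesis by (simp add: algebra_simps)
  next
    case 3
    then have "u q \<le> u x" "0 \<le> v x"
      using mono S zero by (metis mono_onD)+
    moreover from this have "u q * v x \<le> u x * v x" "v p * u x \<le> 0" "u x * v x \<ge> 0"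
      using P zero by (auto intro!: mult_right_mono mult_nonpos_nonneg)
    ultimately show ?thesis by (simp add: algebra_simps)
  qed
qed

lemma Ck_closure_cont_extension:
  assumes "Ck_closure k \<Omega> f" "j \<le> k"
  obtains g where "continuous_on (closure \<Omega>) g" "\<And>x. x \<in> \<Omega> \<Longrightarrow> g x = (deriv ^^ j) f x"
proof -
  have "\<exists>g. continuous_on (closure \<Omega>) g \<and> (\<forall>x\<in>\<Omega>. g x = (deriv ^^ j) f x)"
    using assms by (simp add: Ck_closure_def)
  then show ?thesis
    using that by metis
qed

text \<open>The extension \<open>g\<close> is integrable on the compact closure, hence on \<Omega>,
  where it agrees with \<open>f\<close>. This serves integrands built from derivatives, which are
  controlled only inside \<Omega>.\<close>

lemma set_integrable_if_cont_extension:
  fixes f g :: "real \<Rightarrow> real"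
  assumes "open \<Omega>" "bounded \<Omega>" "continuous_on (closure \<Omega>) g" "\<And>x. x \<in> \<Omega> \<Longrightarrow> f x = g x"
  shows "set_integrable lborel \<Omega> f"
proof -
  have "set_integrable lborel (closure \<Omega>) g"
    unfolding set_integrable_def
    by (rule borel_integrable_compact) (use assms compact_closure in auto)
  then have "set_integrable lborel \<Omega> g"
    by (rule set_integrable_subset) (use assms closure_subset in auto)
  then show ?thesis
    using set_integrable_cong[of lborel lborel \<Omega> \<Omega> f g] assms(4) by auto
qed

text \<open>The interior form of the fundamental theorem gives a gauge integral; the assumed
  integrability identifies it with the Lebesgue integral.\<close>

lemma set_integral_deriv:
  fixes f :: "real \<Rightarrow> real"
  assumes "c < d" "continuous_on {c..d} f" "\<And>x. x \<in> {c<..<d} \<Longrightarrow> f differentiable (at x)"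
    and "set_integrable lborel {c<..<d} (deriv f)"
  shows "(LINT x:{c<..<d}|lborel. deriv f x) = f d - f c"
proof -
  have "(deriv f has_integral (f d - f c)) {c..d}"
  proof (rule fundamental_theorem_of_calculus_interior)
    show "(f has_vector_derivative deriv f x) (at x)" if "x \<in> {c<..<d}" for x
      using assms(3)[OF that]
      by (simp add: DERIV_deriv_iff_real_differentiable
          flip: has_real_derivative_iff_has_vector_derivative)
  qed (use assms in auto)
  then have "integral {c<..<d} (deriv f) = f d - f c"
    using has_integral_Icc_iff_Ioo integral_unique by blast
  then show ?thesis
    using set_borel_integral_eq_integral(2)[OF assms(4)] by simp
qed

lemma Rolle_deriv_zero:
  fixes f :: "real \<Rightarrow> real"
  assumes "c < d" "f c = f d" "continuous_on {c..d} f"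
    and "\<And>x. x \<in> {c<..<d} \<Longrightarrow> f differentiable (at x)"
  obtains z where "z \<in> {c<..<d}" "deriv f z = 0"
proof -
  obtain z where "c < z" "z < d" "DERIV f z :> 0"
    using Rolle[OF assms(1-3)] assms(4) by (meson greaterThanLessThan_iff)
  then show ?thesis
    by (intro that[of z]) (simp_all add: DERIV_imp_deriv)
qed

lemma interval_nonneg_of_zeros:
  fixes a \<phi> \<psi> :: "real \<Rightarrow> real"
  assumes a: "\<And>x. x \<in> {c<..<d} \<Longrightarrow> a x > 0"
    and mono: "mono_on {c<..<d} (\<lambda>x. a x * deriv \<phi> x)" "mono_on {c<..<d} (\<lambda>x. a x * deriv \<psi> x)"
    and int: "set_integrable lborel {c<..<d} (deriv \<phi>)" "set_integrable lborel {c<..<d} (deriv \<psi>)"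
      "set_integrable lborel {c<..<d} (\<lambda>x. a x * (3 * (deriv \<phi> x * deriv \<psi> x) - \<bar>deriv \<phi> x * deriv \<psi> x\<bar>))"
    and zero: "(LINT x:{c<..<d}|lborel. deriv \<phi> x) = 0" "(LINT x:{c<..<d}|lborel. deriv \<psi> x) = 0"
    and pq: "p \<in> {c<..<d}" "deriv \<phi> p = 0" "q \<in> {c<..<d}" "deriv \<psi> q = 0" "p \<le> q"
  shows "0 \<le> (LINT x:{c<..<d}|lborel.
           a x * (3 * (deriv \<phi> x * deriv \<psi> x) - \<bar>deriv \<phi> x * deriv \<psi> x\<bar>))"
proof -
  \<comment> \<open>Twice the flux of \<psi> at the zero of \<phi>', and twice the flux of \<phi> at
    the zero of \<psi>': the coefficients in \<open>mono_zero_product_bound\<close>.\<close>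
  let ?A = "2 * (a p * deriv \<psi> p)" and ?B = "2 * (a q * deriv \<phi> q)"
  have "0 = ?A * (LINT x:{c<..<d}|lborel. deriv \<phi> x) + ?B * (LINT x:{c<..<d}|lborel. deriv \<psi> x)"
    using zero by simp
  also have "\<dots> = (LINT x:{c<..<d}|lborel. ?A * deriv \<phi> x + ?B * deriv \<psi> x)"
    using int by (subst set_integral_add) auto
  also have "\<dots> \<le> (LINT x:{c<..<d}|lborel.
           a x * (3 * (deriv \<phi> x * deriv \<psi> x) - \<bar>deriv \<phi> x * deriv \<psi> x\<bar>))"
  proof (rule set_integral_mono)
    show "set_integrable lborel {c<..<d} (\<lambda>x. ?A * deriv \<phi> x + ?B * deriv \<psi> x)"
      using int by (intro set_integral_add set_integrable_mult_right) auto
  next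
    fix x assume x: "x \<in> {c<..<d}"
    let ?s = "deriv \<phi> x" and ?t = "deriv \<psi> x"
    have "2 * (a p * deriv \<psi> p * (a x * ?s) + a q * deriv \<phi> q * (a x * ?t))
       \<le> 3 * (a x * ?s * (a x * ?t)) - \<bar>a x * ?s * (a x * ?t)\<bar>"
      by (rule mono_zero_product_bound[OF mono]) (use x pq in auto)
    \<comment> \<open>Since \<open>a x\<close> is positive it leaves the absolute value. One factor
      \<open>a x\<close> then cancels from both sides, and the other is the weight of the
      integrand.\<close>
    also have "\<bar>a x * ?s * (a x * ?t)\<bar> = a x * (a x * \<bar>?s * ?t\<bar>)"
      using a[OF x] by (simp add: abs_mult)
    finally have "a x * (?A * ?s + ?B * ?t) \<le> a x * (a x * (3 * (?s * ?t) - \<bar>?s * ?t\<bar>))"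
      by (simp add: algebra_simps)
    then show "?A * ?s + ?B * ?t \<le> a x * (3 * (?s * ?t) - \<bar>?s * ?t\<bar>)"
      using a[OF x] by simp
  qed (use int in auto)
  finally show ?thesis .
qed

text \<open>Sub-harmonicity is the sign condition that the flux has nonnegative derivative. The
  regularity of \<open>a\<close> and \<open>f\<close> makes the flux differentiable, so that the
  value of \<open>deriv\<close> is a genuine derivative.\<close>

lemma subharmonic_flux_mono_on:
  assumes "subharmonic_wrt a \<Omega> f" "Ck_closure 1 \<Omega> a" "{c<..<d} \<subseteq> \<Omega>"
  shows "mono_on {c<..<d} (\<lambda>x. a x * deriv f x)"
proof (rule mono_onI)
  fix r s assume rs: "r \<in> {c<..<d}" "s \<in> {c<..<d}" "r \<le> s"
  show "a r * deriv f r \<le> a s * deriv f s"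
  proof (rule DERIV_nonneg_imp_nondecreasing[OF rs(3)])
    fix x assume "r \<le> x" "x \<le> s"
    then have x: "x \<in> \<Omega>" using rs assms(3) by auto
    have "a differentiable at x"
      using assms(2) x unfolding Ck_closure_def by (auto dest: spec[of _ 0])
    moreover have "deriv f differentiable at x"
      using assms(1) x unfolding subharmonic_wrt_def Ck_closure_def by (auto dest: spec[of _ 1])
    ultimately have "(\<lambda>y. a y * deriv f y) differentiable at x" by simp
    moreover have "deriv (\<lambda>y. a y * deriv f y) x \<ge> 0"
      using assms(1) x unfolding subharmonic_wrt_def neg_div_grad_def by auto
    ultimately show "\<exists>y. DERIV (\<lambda>y. a y * deriv f y) x :> y \<and> y \<ge> 0"
      using DERIV_deriv_iff_real_differentiable by blast
  qed
qed

theorem theorem2p11: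
  fixes \<Omega> :: "real set" and a \<phi> \<psi> :: "real \<Rightarrow> real"
  assumes "open \<Omega>" and "bounded \<Omega>"
    and "Cinf_closure \<Omega> a" and "\<forall>x\<in>closure \<Omega>. a x > 0"
    and "Ck_closure 2 \<Omega> \<phi>" and "Ck_closure 2 \<Omega> \<psi>"
    and "\<forall>x\<in>frontier \<Omega>. \<phi> x = 0" and "\<forall>x\<in>frontier \<Omega>. \<psi> x = 0"
    and "subharmonic_wrt a \<Omega> \<phi>" and "subharmonic_wrt a \<Omega> \<psi>"
  shows "(LINT x:\<Omega>|lborel. a x * \<bar>deriv \<phi> x * deriv \<psi> x\<bar>)
           \<le> 3 * (LINT x:\<Omega>|lborel. a x * (deriv \<phi> x * deriv \<psi> x))"
proof -
  obtain g where g: "continuous_on (closure \<Omega>) g" "\<And>x. x \<in> \<Omega> \<Longrightarrow> g x = deriv \<phi> x"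
    using Ck_closure_cont_extension[OF assms(5), of 1] by auto
  obtain h where h: "continuous_on (closure \<Omega>) h" "\<And>x. x \<in> \<Omega> \<Longrightarrow> h x = deriv \<psi> x"
    using Ck_closure_cont_extension[OF assms(6), of 1] by auto
  have a1: "Ck_closure 1 \<Omega> a"
    using assms(3) by (simp add: Cinf_closure_def)
  then have ca: "continuous_on (closure \<Omega>) a"
    by (simp add: Ck_closure_def)
  note sint = set_integrable_if_cont_extension[OF assms(1,2)]
  have int1: "set_integrable lborel \<Omega> (\<lambda>x. a x * \<bar>deriv \<phi> x * deriv \<psi> x\<bar>)"
    by (rule sint[of "\<lambda>x. a x * \<bar>g x * h x\<bar>"]) (use g h in \<open>auto intro!: continuous_intros ca\<close>)
  have int2: "set_integrable lborel \<Omega> (\<lambda>x. a x * (deriv \<phi> x * deriv \<psi> x))"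
    by (rule sint[of "\<lambda>x. a x * (g x * h x)"]) (use g h in \<open>auto intro!: continuous_intros ca\<close>)
  have int\<phi>: "set_integrable lborel \<Omega> (deriv \<phi>)" and int\<psi>: "set_integrable lborel \<Omega> (deriv \<psi>)"
    using g h by (auto intro: sint)
  \<comment> \<open>Both sides of the claim are merged into one integrand, so that only the sign of
    its integral on each component has to be found.\<close>
  let ?F = "\<lambda>x. a x * (3 * (deriv \<phi> x * deriv \<psi> x) - \<bar>deriv \<phi> x * deriv \<psi> x\<bar>)"
  have F_eq: "?F = (\<lambda>x. 3 * (a x * (deriv \<phi> x * deriv \<psi> x)) - a x * \<bar>deriv \<phi> x * deriv \<psi> x\<bar>)"
    by (auto simp: algebra_simps)
  have intF: "set_integrable lborel \<Omega> ?F"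
    unfolding F_eq using int1 int2 by (intro set_integral_diff set_integrable_mult_right) auto
  have comp: "0 \<le> (LINT x:C|lborel. ?F x)" if C: "C \<in> components \<Omega>" for C
  proof -
    obtain c d where cd: "c < d" "C = {c<..<d}" "c \<in> frontier \<Omega>" "d \<in> frontier \<Omega>"
      using open_bounded_component_real[OF assms(1,2) C] .
    have sub: "{c<..<d} \<subseteq> \<Omega>"
      using C cd in_components_subset by blast
    have sub': "{c..d} \<subseteq> closure \<Omega>"
      using closure_mono[OF sub] cd by (simp add: closure_greaterThanLessThan)
    have apos: "a x > 0" if "x \<in> {c<..<d}" for x
      using that sub assms(4) closure_subset by blast
    have bc: "\<phi> c = 0" "\<phi> d = 0" "\<psi> c = 0" "\<psi> d = 0"
      using cd assms(7,8) by auto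
    have cont: "continuous_on {c..d} \<phi>" "continuous_on {c..d} \<psi>"
      using assms(5,6) sub' continuous_on_subset unfolding Ck_closure_def by blast+
    have diff: "\<phi> differentiable at x" "\<psi> differentiable at x" if "x \<in> {c<..<d}" for x
      using assms(5,6) sub that unfolding Ck_closure_def by (auto dest!: spec[of _ 0])
    have int: "set_integrable lborel {c<..<d} (deriv \<phi>)" "set_integrable lborel {c<..<d} (deriv \<psi>)"
      "set_integrable lborel {c<..<d} ?F"
      using int\<phi> int\<psi> intF sub by (auto intro: set_integrable_subset)
    \<comment> \<open>Both functions vanish at the two endpoints; the same fact feeds Rolle
      below.\<close>
    have zero: "(LINT x:{c<..<d}|lborel. deriv \<phi> x) = 0" "(LINT x:{c<..<d}|lborel. deriv \<psi> x) = 0"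
      using set_integral_deriv[OF cd(1) cont(1) diff(1) int(1)]
        set_integral_deriv[OF cd(1) cont(2) diff(2) int(2)] bc by auto
    obtain p where p: "p \<in> {c<..<d}" "deriv \<phi> p = 0"
      using Rolle_deriv_zero[OF cd(1) _ cont(1) diff(1)] bc by auto
    obtain q where q: "q \<in> {c<..<d}" "deriv \<psi> q = 0"
      using Rolle_deriv_zero[OF cd(1) _ cont(2) diff(2)] bc by auto
    have mono: "mono_on {c<..<d} (\<lambda>x. a x * deriv \<phi> x)" "mono_on {c<..<d} (\<lambda>x. a x * deriv \<psi> x)"
      using subharmonic_flux_mono_on[OF _ a1 sub] assms(9,10) by auto
    show ?thesis
    proof (cases "p \<le> q")
      case True
      show ?thesis
        unfolding cd(2) by (rule interval_nonneg_of_zeros[OF apos mono int zero p q True])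
    next
      case False
      then have "q \<le> p" by simp
      \<comment> \<open>The integrand is symmetric in \<phi> and \<psi>, so exchanging their roles
        reduces to the previous case.\<close>
      moreover have "?F = (\<lambda>x. a x * (3 * (deriv \<psi> x * deriv \<phi> x) - \<bar>deriv \<psi> x * deriv \<phi> x\<bar>))"
        by (simp add: mult.commute)
      ultimately show ?thesis
        using interval_nonneg_of_zeros[OF apos mono(2,1) int(2,1) _ zero(2,1) q p] int(3)
        unfolding cd(2) by simp
    qed
  qed
  have disj: "disjoint (components \<Omega>)"
    using pairwise_disjoint_components[of \<Omega>] by (simp add: pairwise_def disjnt_def)
  have op: "open C" if "C \<in> components \<Omega>" for C
    using that assms(1) open_components by blast
  \<comment> \<open>Disjoint open sets of reals form a countable family, as the summation over
    components requires.\<close>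
  have "countable (components \<Omega>)"
    using countable_disjoint_open_subsets[OF op disj] .
  then have "0 \<le> (LINT x:\<Union>(components \<Omega>)|lborel. ?F x)"
    by (rule set_integral_Union_nonneg) (use disj op intF comp in auto)
  then have "0 \<le> (LINT x:\<Omega>|lborel. ?F x)"
    by simp
  also have "\<dots> = 3 * (LINT x:\<Omega>|lborel. a x * (deriv \<phi> x * deriv \<psi> x))
      - (LINT x:\<Omega>|lborel. a x * \<bar>deriv \<phi> x * deriv \<psi> x\<bar>)"
    unfolding F_eq using int1 int2 by (subst set_integral_diff) auto
  finally show ?thesis by simp
qed

end
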